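(* Let $T\ge 2$, let $L,l$ be integers with $1\le L\le T-1$ and $1\le l\le T-1$, let $0\le\underline{p}\le\overline{p}$, and let $c,h\in\mathbb{R}$. Let $[\underline{p},\overline{p}]=\bigcup_{k\in\mathcal{K}}\mathcal{I}_k$ be a partition into finitely many intervals, and let $a_k,b_k\in\mathbb{R}$ ($k\in\mathcal{K}$) be such that the function on $[\underline{p},\overline{p}]$ equal to $a_k p+b_k$ for $p\in\mathcal{I}_k$ is well defined and convex. Let $\mathcal{X}$ be the set of all $(\bm{p},\bm{x},\bm{u})$ with $\bm{p}\in\mathbb{R}^T$, $\bm{x}\in\{0,1\}^T$, $\bm{u}=(u_2,\dots,u_T)\in\{0,1\}^{T-1}$ satisfying - $u_t\ge x_t-x_{t-1}$ for all $t\in[2,T]$; - $\sum_{i=t-L+1}^{t}u_i\le x_t$ for all $t\in[L+1,T]$; - $\sum_{i=t-l+1}^{t}u_i\le 1-x_{t-l}$ for all $t\in[l+1,T]$; - $x_t\underline{p}\le p_t\le x_t\overline{p}$ for all $t\in[1,T]$. Let $\tilde{C}:\mathcal{X}\to\mathbb{R}$ be the convex piecewise linear cost function $\tilde{C}(\bm{p},\bm{x},\bm{u})=\sum_{t=1}^T\tilde{C}_t(p_t,x_t,u_t)$, where $$\tilde{C}_t(p_t,x_t,u_t)=\begin{cases} a_k p_t+b_k+c+h u_t, & x_t=1,\ p_t\in\mathcal{I}_k,\\ h u_t, & x_t=0.\end{cases}$$ Then the convex envelope of $\tilde{C}$ taken over $\mathcal{X}$ is the function $\tilde{C}^{**}:\mathrm{conv}(\mathcal{X})\to\mathbb{R}$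 given by $$\tilde{C}^{**}(\bm{p},\bm{x},\bm{u})=\sum_{t=1}^{T}\begin{cases} a_k p_t+(c+b_k)x_t+h u_t, & \text{if } x_t>0 \text{ and } \dfrac{p_t}{x_t}\in\mathcal{I}_k,\\[4pt] 0, & \text{if } x_t=0.\end{cases}$$
   Context: The start-up variables $u_t$ are defined only for $t=2,\dots,T$; in all sums the term $h u_1$ is absent (read as $0$). Here $h$ is the start-up cost, $c$ the no-load cost, and $a_kp+b_k$ the operating cost (excluding start-up and no-load cost) when the unit is on at level $p\in\mathcal{I}_k$. Index ranges $[a,b]$ denote integers. The convex envelope of a function taken over a (possibly non-convex) set $\mathcal{X}$ is the largest convex function on $\mathrm{conv}(\mathcal{X})$ that is an under-estimator of the function on $\mathcal{X}$, where $\mathrm{conv}(\cdot)$ is the convex hull. *)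

theory Defs
  imports "HOL-Analysis.Analysis" "HOL-Library.Function_Algebras"
begin

(* A vector of R^T is represented by a function on nat that vanishes outside its index range.
   The pointwise vector space structure makes the library's convex hull and convex_on available;
   on such functions it is the one of R^T. *)

instantiation "fun" :: (type, real_vector) real_vector
begin

definition scaleR_fun :: "real \<Rightarrow> ('a \<Rightarrow> 'b) \<Rightarrow> 'a \<Rightarrow> 'b"
  where "scaleR_fun r f = (\<lambda>i. r *\<^sub>R f i)"

instance
  by standard (simp_all add: scaleR_fun_def fun_eq_iff scaleR_right_distrib scaleR_left_distrib)

end

type_synonym schedule = "(nat \<Rightarrow> real) \<times> (nat \<Rightarrow> real) \<times> (nat \<Rightarrow> real)"

(* Pieces of a partition may be open, half-open or closed, and neighbouring pieces may share
   an endpoint. *)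

definition interval_partition :: "'k set \<Rightarrow> ('k \<Rightarrow> real set) \<Rightarrow> real set \<Rightarrow> bool"
  where "interval_partition K I S \<longleftrightarrow>
    finite K \<and>
    (\<forall>k\<in>K. is_interval (I k) \<and> I k \<noteq> {}) \<and>
    (\<forall>j\<in>K. \<forall>k\<in>K. j \<noteq> k \<longrightarrow> interior (I j) \<inter> interior (I k) = {}) \<and>
    (\<Union>k\<in>K. I k) = S"

definition pieces_agree :: "'k set \<Rightarrow> ('k \<Rightarrow> real set) \<Rightarrow> ('k \<Rightarrow> real) \<Rightarrow> ('k \<Rightarrow> real) \<Rightarrow> bool"
  where "pieces_agree K I a b \<longleftrightarrow>
    (\<forall>j\<in>K. \<forall>k\<in>K. \<forall>q \<in> I j \<inter> I k. a j * q + b j = a k * q + b k)"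

definition piecewise_affine ::
  "'k set \<Rightarrow> ('k \<Rightarrow> real set) \<Rightarrow> ('k \<Rightarrow> real) \<Rightarrow> ('k \<Rightarrow> real) \<Rightarrow> real \<Rightarrow> real"
  where "piecewise_affine K I a b q = (THE y. \<exists>k\<in>K. q \<in> I k \<and> y = a k * q + b k)"

lemma piecewise_affine_eq:
  assumes "pieces_agree K I a b" "k \<in> K" "q \<in> I k"
  shows "piecewise_affine K I a b q = a k * q + b k"
  unfolding piecewise_affine_def
proof (rule the_equality)
  show "\<exists>j\<in>K. q \<in> I j \<and> a k * q + b k = a j * q + b j"
    by (rule bexI [OF _ assms(2)]) (simp add: assms(3))
next
  fix y
  assume "\<exists>j\<in>K. q \<in> I j \<and> y = a j * q + b j"
  then obtain j where j: "j \<in> K" "q \<in> I j" "y = a j * q + b j"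
    by blast
  have "a j * q + b j = a k * q + b k"
    using assms j(1,2) unfolding pieces_agree_def by blast
  with j(3) show "y = a k * q + b k"
    by simp
qed

(* The start-up variables exist for t = 2, ..., T only, so the component u 1 is forced to 0;
   this is what makes the term h * u 1 absent from the cost functions below. *)

definition feasible_schedules :: "nat \<Rightarrow> nat \<Rightarrow> nat \<Rightarrow> real \<Rightarrow> real \<Rightarrow> schedule set"
  where "feasible_schedules T L l pmin pmax = {(p, x, u).
    (\<forall>t. t \<notin> {1..T} \<longrightarrow> p t = 0 \<and> x t = 0) \<and>
    (\<forall>t. t \<notin> {2..T} \<longrightarrow> u t = 0) \<and>
    (\<forall>t\<in>{1..T}. x t \<in> {0, 1}) \<and>
    (\<forall>t\<in>{2..T}. u t \<in> {0, 1}) \<and>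
    (\<forall>t\<in>{2..T}. u t \<ge> x t - x (t - 1)) \<and>
    (\<forall>t\<in>{L + 1..T}. (\<Sum>i = t - L + 1..t. u i) \<le> x t) \<and>
    (\<forall>t\<in>{l + 1..T}. (\<Sum>i = t - l + 1..t. u i) \<le> 1 - x (t - l)) \<and>
    (\<forall>t\<in>{1..T}. x t * pmin \<le> p t \<and> p t \<le> x t * pmax)}"

definition schedule_cost ::
  "nat \<Rightarrow> 'k set \<Rightarrow> ('k \<Rightarrow> real set) \<Rightarrow> ('k \<Rightarrow> real) \<Rightarrow> ('k \<Rightarrow> real) \<Rightarrow> real \<Rightarrow> real
    \<Rightarrow> schedule \<Rightarrow> real"
  where "schedule_cost T K I a b c h = (\<lambda>(p, x, u).
    \<Sum>t = 1..T. if x t = 1 then piecewise_affine K I a b (p t) + c + h * u t else h * u t)"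

definition perspective_piece ::
  "'k set \<Rightarrow> ('k \<Rightarrow> real set) \<Rightarrow> ('k \<Rightarrow> real) \<Rightarrow> ('k \<Rightarrow> real) \<Rightarrow> real \<Rightarrow> real
    \<Rightarrow> real \<Rightarrow> real \<Rightarrow> real \<Rightarrow> real"
  where "perspective_piece K I a b c h q y v =
    (THE w. \<exists>k\<in>K. q / y \<in> I k \<and> w = a k * q + (c + b k) * y + h * v)"

lemma perspective_piece_eq:
  assumes "pieces_agree K I a b" "k \<in> K" "y > 0" "q / y \<in> I k"
  shows "perspective_piece K I a b c h q y v = a k * q + (c + b k) * y + h * v"
  unfolding perspective_piece_def
proof (rule the_equality)
  show "\<exists>k'\<in>K. q / y \<in> I k' \<and>
      a k * q + (c + b k) * y + h * v = a k' * q + (c + b k') * y + h * v"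
    by (rule bexI [OF _ assms(2)]) (simp add: assms(4))
next
  fix w
  assume "\<exists>k'\<in>K. q / y \<in> I k' \<and> w = a k' * q + (c + b k') * y + h * v"
  then obtain j where j: "j \<in> K" "q / y \<in> I j" "w = a j * q + (c + b j) * y + h * v"
    by blast
  have "a j * (q / y) + b j = a k * (q / y) + b k"
    using assms(1,2,4) j(1,2) unfolding pieces_agree_def by blast
  then have "(a j * (q / y) + b j) * y = (a k * (q / y) + b k) * y"
    by simp
  then have "a j * q + b j * y = a k * q + b k * y"
    using \<open>y > 0\<close> by (simp add: distrib_right)
  then show "w = a k * q + (c + b k) * y + h * v"
    unfolding j(3) by (simp add: distrib_right)
qed

(* On the convex hull of the feasible schedules every x t is nonnegative, so the else branch
   there is the case x t = 0. *)

definition envelope_cost ::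
  "nat \<Rightarrow> 'k set \<Rightarrow> ('k \<Rightarrow> real set) \<Rightarrow> ('k \<Rightarrow> real) \<Rightarrow> ('k \<Rightarrow> real) \<Rightarrow> real \<Rightarrow> real
    \<Rightarrow> schedule \<Rightarrow> real"
  where "envelope_cost T K I a b c h = (\<lambda>(p, x, u).
    \<Sum>t = 1..T. if x t > 0 then perspective_piece K I a b c h (p t) (x t) (u t) else 0)"

(* Values of g outside the convex hull of S are irrelevant; on it g is uniquely determined. *)

definition is_convex_envelope ::
  "'v::real_vector set \<Rightarrow> ('v \<Rightarrow> real) \<Rightarrow> ('v \<Rightarrow> real) \<Rightarrow> bool"
  where "is_convex_envelope S f g \<longleftrightarrow>
    convex_on (convex hull S) g \<and> (\<forall>z\<in>S. g z \<le> f z) \<and>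
    (\<forall>g'. convex_on (convex hull S) g' \<and> (\<forall>z\<in>S. g' z \<le> f z) \<longrightarrow>
      (\<forall>z\<in>convex hull S. g' z \<le> g z))"

end

theory Submission
  imports Defs
begin

text \<open>
  On the hull the proposed envelope is a sum of perspectives \<open>x \<phi>(p / x)\<close> of the convex
  function \<open>\<phi>\<close> plus a linear term, hence convex. For maximality fix a hull point and let
  \<open>r t\<close> be its normalised output \<open>p t / x t\<close>. The linear map replacing the output \<open>p\<close> by
  \<open>r * x\<close> fixes this point and maps feasible schedules to feasible ones, and along it the
  cost is linear in \<open>(x, u)\<close>. A convex underestimator composed with this map is therefore
  below a linear functional on the feasible set, and so on the whole hull. In particular no
  description of the hull by inequalities is needed.
\<close>

section \<open>Comparing convex and affine functions on a hull\<close>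

text \<open>The hull points at which \<open>f\<close> stays below \<open>g\<close> form a convex
  set, because \<open>f\<close> is convex and \<open>g\<close> is affine; this set contains
  \<open>S\<close>, hence is the whole hull.\<close>

lemma convex_on_le_affine_on_hull:
  fixes f g :: "'v::real_vector \<Rightarrow> real"
  assumes f: "convex_on (convex hull S) f"
    and g: "\<And>z w s t. s + t = 1 \<Longrightarrow> g (s *\<^sub>R z + t *\<^sub>R w) = s * g z + t * g w"
    and le: "\<And>z. z \<in> S \<Longrightarrow> f z \<le> g z"
    and z: "z \<in> convex hull S"
  shows "f z \<le> g z"
proof -
  have "convex hull S \<subseteq> {z \<in> convex hull S. f z \<le> g z}"
  proof (rule hull_minimal)
    show "S \<subseteq> {z \<in> convex hull S. f z \<le> g z}"
      using le hull_subset by fastforce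
    show "convex {z \<in> convex hull S. f z \<le> g z}"
    proof (rule convexI, clarify)
      fix v w and s t :: real
      assume st: "0 \<le> s" "0 \<le> t" "s + t = 1"
        and v: "v \<in> convex hull S" "f v \<le> g v" and w: "w \<in> convex hull S" "f w \<le> g w"
      have "f (s *\<^sub>R v + t *\<^sub>R w) \<le> s * f v + t * f w"
        using f st v(1) w(1) by (simp add: convex_on_def)
      also have "\<dots> \<le> s * g v + t * g w"
        using st v(2) w(2) by (intro add_mono mult_left_mono)
      finally show "s *\<^sub>R v + t *\<^sub>R w \<in> convex hull S \<and>
          f (s *\<^sub>R v + t *\<^sub>R w) \<le> g (s *\<^sub>R v + t *\<^sub>R w)"
        using g st convexD [OF convex_convex_hull v(1) w(1)] by simp
    qed
  qed
  with z show ?thesis by blast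
qed

section \<open>Perspectives of convex functions\<close>

text \<open>Since \<open>q / 0 = 0\<close>, the expression \<open>y * \<phi> (q / y)\<close> vanishes at \<open>y = 0\<close>, as the
  perspective should.\<close>

lemma perspective_convex:
  fixes \<phi> :: "real \<Rightarrow> real"
  assumes \<phi>: "convex_on {m..M} \<phi>"
    and y: "0 \<le> y" "y * m \<le> q" "q \<le> y * M"
    and y': "0 \<le> y'" "y' * m \<le> q'" "q' \<le> y' * M"
    and st: "0 \<le> s" "0 \<le> t"
  shows "(s * y + t * y') * \<phi> ((s * q + t * q') / (s * y + t * y'))
    \<le> s * (y * \<phi> (q / y)) + t * (y' * \<phi> (q' / y'))"
proof (cases "s * y = 0 \<or> t * y' = 0")
  \<comment> \<open>If \<open>y = 0\<close>, the bounds force \<open>q = 0\<close>. So a term of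
    weight zero drops out of numerator and denominator alike, and the remaining factor cancels in
    the quotient.\<close>
  case True
  have "s * q = 0" if "s * y = 0"
    using that y by auto
  moreover have "t * q' = 0" if "t * y' = 0"
    using that y' by auto
  ultimately show ?thesis
    using True by auto
next
  case False
  \<comment> \<open>The combined ratio is the convex combination of \<open>q / y\<close> and
    \<open>q' / y'\<close> with weights \<open>s * y / d\<close> and \<open>t * y' / d\<close>;
    convexity of \<open>\<phi>\<close> is applied there and scaled by \<open>d\<close>.\<close>
  define d where "d = s * y + t * y'"
  have pos: "s > 0" "t > 0" "y > 0" "y' > 0"
    using False st y y' by (auto simp: less_le)
  then have d: "d > 0"
    unfolding d_def by (simp add: add_pos_pos)
  have "q / y \<in> {m..M}" "q' / y' \<in> {m..M}"
    using pos y y' by (simp_all add: field_simps)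
  moreover have "s * y / d + t * y' / d = 1"
    using d by (simp add: d_def add_divide_distrib [symmetric])
  moreover have "0 \<le> s * y / d" "0 \<le> t * y' / d"
    using pos d by simp_all
  ultimately have "\<phi> ((s * y / d) * (q / y) + (t * y' / d) * (q' / y'))
      \<le> (s * y / d) * \<phi> (q / y) + (t * y' / d) * \<phi> (q' / y')"
    using \<phi> unfolding convex_on_def real_scaleR_def by blast
  also have "(s * y / d) * (q / y) + (t * y' / d) * (q' / y') = (s * q + t * q') / d"
    using pos d by (simp add: field_simps)
  finally have "d * \<phi> ((s * q + t * q') / d)
      \<le> d * ((s * y / d) * \<phi> (q / y) + (t * y' / d) * \<phi> (q' / y'))"
    using d by (intro mult_left_mono) auto
  also have "\<dots> = s * (y * \<phi> (q / y)) + t * (y' * \<phi> (q' / y'))"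
    using d by (simp add: field_simps)
  finally show ?thesis
    unfolding d_def .
qed

text \<open>The bounds on \<open>q\<close> put \<open>q / y\<close> into some piece, and
  \<open>a k * q + b k * y\<close> is \<open>y\<close> times the value of that piece at
  \<open>q / y\<close>. This removes the choice of \<open>k\<close> from the formula.\<close>

lemma perspective_piece_eq_perspective:
  assumes "interval_partition K I {pmin..pmax}" "pieces_agree K I a b"
    and "y > 0" "y * pmin \<le> q" "q \<le> y * pmax"
  shows "perspective_piece K I a b c h q y v
    = y * piecewise_affine K I a b (q / y) + c * y + h * v"
proof -
  have "q / y \<in> {pmin..pmax}"
    using assms(3-5) by (simp add: field_simps)
  then obtain k where "k \<in> K" "q / y \<in> I k"
    using assms(1) unfolding interval_partition_def by blast
  then show ?thesis
    using assms(2,3)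
    by (simp add: perspective_piece_eq piecewise_affine_eq field_simps)
qed

section \<open>Bounds valid on the hull\<close>

text \<open>For \<open>t \<le> L\<close> there is no minimum up-time constraint at \<open>t\<close>; there the bound comes from
  the constraint at \<open>L + 1\<close> together with the start-ups that reach \<open>x (L + 1)\<close> from \<open>x t\<close>.\<close>

lemma startup_le_on:
  fixes x u :: "nat \<Rightarrow> real"
  assumes L: "1 \<le> L" "L + 1 \<le> T"
    and u0: "\<And>t. t \<in> {2..T} \<Longrightarrow> 0 \<le> u t"
    and startup: "\<And>t. t \<in> {2..T} \<Longrightarrow> x t - x (t - 1) \<le> u t"
    and uptime: "\<And>t. t \<in> {L + 1..T} \<Longrightarrow> (\<Sum>i = t - L + 1..t. u i) \<le> x t"
    and t: "t \<in> {2..T}"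
  shows "u t \<le> x t"
proof (cases "L + 1 \<le> t")
  case True
  have "u t \<le> (\<Sum>i = t - L + 1..t. u i)"
    using True L t by (intro member_le_sum u0) auto
  also have "\<dots> \<le> x t"
    using uptime True t by simp
  finally show ?thesis .
next
  case False
  have telescope: "x n - x t \<le> (\<Sum>i = Suc t..n. u i)" if "t \<le> n" "n \<le> T" for n
    using that
  proof (induction n rule: dec_induct)
    case base
    show ?case by simp
  next
    case (step n)
    then show ?case
      using startup [of "Suc n"] t by simp
  qed
  have "u t + (\<Sum>i = Suc t..L + 1. u i) = (\<Sum>i = t..L + 1. u i)"
    using False by (simp add: sum.atLeast_Suc_atMost)
  also have "\<dots> \<le> (\<Sum>i = 2..L + 1. u i)"
    using t L False by (intro sum_mono2 u0) auto
  also have "\<dots> \<le> x (L + 1)"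
    using uptime [of "L + 1"] L by (simp add: numeral_2_eq_2)
  \<comment> \<open>Adding \<open>x (L + 1) - x t\<close> to \<open>u t\<close> gives at most
    \<open>x (L + 1)\<close>, which then cancels.\<close>
  finally show ?thesis
    using telescope [of "L + 1"] False L by simp
qed

text \<open>These are homogeneous linear inequalities, so they cut out a convex set and it suffices
  to check them on feasible schedules. Every index \<open>t\<close> is allowed, since components
  outside their range are 0.\<close>

lemma hull_feasible_schedules_bounds:
  assumes L: "1 \<le> L" "L + 1 \<le> T"
    and z: "(p, x, u) \<in> convex hull (feasible_schedules T L l pmin pmax)"
  shows "0 \<le> x t" "x t * pmin \<le> p t" "p t \<le> x t * pmax" "0 \<le> u t" "u t \<le> x t"
proof -
  let ?B = "{(p, x, u). 0 \<le> x t \<and> x t * pmin \<le> p t \<and> p t \<le> x t * pmax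
    \<and> 0 \<le> u t \<and> u t \<le> x t} :: schedule set"
  have "convex hull (feasible_schedules T L l pmin pmax) \<subseteq> ?B"
  proof (rule hull_minimal)
    show "feasible_schedules T L l pmin pmax \<subseteq> ?B"
    proof clarify
      fix p x u
      assume "(p, x, u) \<in> feasible_schedules T L l pmin pmax"
      then have X: "\<And>t. t \<notin> {1..T} \<Longrightarrow> p t = 0 \<and> x t = 0" "\<And>t. t \<notin> {2..T} \<Longrightarrow> u t = 0"
          "\<And>t. t \<in> {1..T} \<Longrightarrow> x t \<in> {0, 1}" "\<And>t. t \<in> {2..T} \<Longrightarrow> u t \<in> {0, 1}"
          "\<And>t. t \<in> {2..T} \<Longrightarrow> x t - x (t - 1) \<le> u t"
          "\<And>t. t \<in> {L + 1..T} \<Longrightarrow> (\<Sum>i = t - L + 1..t. u i) \<le> x t"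
          "\<And>t. t \<in> {1..T} \<Longrightarrow> x t * pmin \<le> p t \<and> p t \<le> x t * pmax"
        unfolding feasible_schedules_def by auto
      have u0: "0 \<le> u s" for s
        using X(2,4) [of s] by (cases "s \<in> {2..T}") auto
      have x0: "0 \<le> x t"
        using X(1,3) [of t] by (cases "t \<in> {1..T}") auto
      moreover have "x t * pmin \<le> p t \<and> p t \<le> x t * pmax"
        using X(1,7) [of t] by (cases "t \<in> {1..T}") auto
      moreover have "u t \<le> x t"
        using startup_le_on [OF L u0 X(5,6), of t] X(2) x0 by (cases "t \<in> {2..T}") auto
      ultimately show "0 \<le> x t \<and> x t * pmin \<le> p t \<and> p t \<le> x t * pmax \<and> 0 \<le> u t \<and> u t \<le> x t"
        using u0 by blast
    qed
    show "convex ?B"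
    proof (rule convexI)
      fix z z' :: schedule and s r :: real
      assume st: "0 \<le> s" "0 \<le> r" and B: "z \<in> ?B" "z' \<in> ?B"
      obtain p x u p' x' u' where eq: "z = (p, x, u)" "z' = (p', x', u')"
        by (metis prod.collapse)
      have v: "0 \<le> x t" "x t * pmin \<le> p t" "p t \<le> x t * pmax" "0 \<le> u t" "u t \<le> x t"
        and w: "0 \<le> x' t" "x' t * pmin \<le> p' t" "p' t \<le> x' t * pmax" "0 \<le> u' t" "u' t \<le> x' t"
        using B by (auto simp: eq)
      have "0 \<le> s * x t + r * x' t" "0 \<le> s * u t + r * u' t"
          "s * u t + r * u' t \<le> s * x t + r * x' t"
        using st v w by (auto intro!: add_mono mult_left_mono)
      moreover have "s * (x t * pmin) + r * (x' t * pmin) \<le> s * p t + r * p' t"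
          "s * p t + r * p' t \<le> s * (x t * pmax) + r * (x' t * pmax)"
        using st v w by (auto intro!: add_mono mult_left_mono)
      ultimately show "s *\<^sub>R z + r *\<^sub>R z' \<in> ?B"
        by (simp add: eq scaleR_fun_def algebra_simps)
    qed
  qed
  with z show "0 \<le> x t" "x t * pmin \<le> p t" "p t \<le> x t * pmax" "0 \<le> u t" "u t \<le> x t"
    by auto
qed

section \<open>Convexity of the envelope and agreement with the cost\<close>

text \<open>Where \<open>x t = 0\<close>, the bound \<open>u t \<le> x t\<close> forces
  \<open>u t = 0\<close>, so the branch with value 0 fits the same formula.\<close>

lemma envelope_cost_on_hull:
  assumes L: "1 \<le> L" "L + 1 \<le> T"
    and part: "interval_partition K I {pmin..pmax}" "pieces_agree K I a b"
    and z: "(p, x, u) \<in> convex hull (feasible_schedules T L l pmin pmax)"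
  shows "envelope_cost T K I a b c h (p, x, u)
    = (\<Sum>t = 1..T. x t * piecewise_affine K I a b (p t / x t) + c * x t + h * u t)"
  unfolding envelope_cost_def prod.case
proof (rule sum.cong [OF refl])
  fix t
  note B = hull_feasible_schedules_bounds [OF L z, of t]
  show "(if x t > 0 then perspective_piece K I a b c h (p t) (x t) (u t) else 0)
      = x t * piecewise_affine K I a b (p t / x t) + c * x t + h * u t"
  proof (cases "x t = 0")
    case True
    then show ?thesis
      using B(4,5) by simp
  next
    case False
    then have "0 < x t"
      using B(1) by simp
    then show ?thesis
      using perspective_piece_eq_perspective [OF part _ B(2,3)] by simp
  qed
qed

lemma envelope_cost_convex_on_hull:
  assumes L: "1 \<le> L" "L + 1 \<le> T"
    and part: "interval_partition K I {pmin..pmax}" "pieces_agree K I a b"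
    and \<phi>: "convex_on {pmin..pmax} (piecewise_affine K I a b)"
  shows "convex_on (convex hull (feasible_schedules T L l pmin pmax))
    (envelope_cost T K I a b c h)"
  unfolding convex_on_def
proof (intro conjI ballI allI impI convex_convex_hull)
  fix z z' :: schedule and s r :: real
  assume z: "z \<in> convex hull (feasible_schedules T L l pmin pmax)"
    and z': "z' \<in> convex hull (feasible_schedules T L l pmin pmax)"
    and st: "0 \<le> s" "0 \<le> r" "s + r = 1"
  obtain p x u p' x' u' where eq: "z = (p, x, u)" "z' = (p', x', u')"
    by (metis prod.collapse)
  note z = z [unfolded eq] and z' = z' [unfolded eq]
  let ?\<phi> = "piecewise_affine K I a b"
  have mem: "(s *\<^sub>R p + r *\<^sub>R p', s *\<^sub>R x + r *\<^sub>R x', s *\<^sub>R u + r *\<^sub>R u')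
      \<in> convex hull (feasible_schedules T L l pmin pmax)"
    using convexD [OF convex_convex_hull z z' st] by simp
  have "envelope_cost T K I a b c h (s *\<^sub>R z + r *\<^sub>R z')
      = (\<Sum>t = 1..T. (s * x t + r * x' t) * ?\<phi> ((s * p t + r * p' t) / (s * x t + r * x' t))
          + c * (s * x t + r * x' t) + h * (s * u t + r * u' t))"
    unfolding eq using envelope_cost_on_hull [OF L part mem] by (simp add: scaleR_fun_def)
  also have "\<dots> \<le> (\<Sum>t = 1..T. s * (x t * ?\<phi> (p t / x t)) + r * (x' t * ?\<phi> (p' t / x' t))
          + c * (s * x t + r * x' t) + h * (s * u t + r * u' t))"
    by (intro sum_mono add_right_mono perspective_convex [OF \<phi>] st
        hull_feasible_schedules_bounds [OF L z] hull_feasible_schedules_bounds [OF L z'])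
  also have "\<dots> = s * envelope_cost T K I a b c h z + r * envelope_cost T K I a b c h z'"
    unfolding eq envelope_cost_on_hull [OF L part z] envelope_cost_on_hull [OF L part z']
    by (simp add: sum_distrib_left sum.distrib [symmetric] algebra_simps)
  finally show "envelope_cost T K I a b c h (s *\<^sub>R z + r *\<^sub>R z')
      \<le> s * envelope_cost T K I a b c h z + r * envelope_cost T K I a b c h z'" .
qed

text \<open>For \<open>x t = 1\<close> the ratio \<open>p t / x t\<close> is \<open>p t\<close>
  itself; for \<open>x t = 0\<close> both summands are \<open>h * u t\<close>.\<close>

lemma envelope_cost_eq_schedule_cost:
  assumes L: "1 \<le> L" "L + 1 \<le> T"
    and part: "interval_partition K I {pmin..pmax}" "pieces_agree K I a b"
    and z: "z \<in> feasible_schedules T L l pmin pmax"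
  shows "envelope_cost T K I a b c h z = schedule_cost T K I a b c h z"
proof -
  obtain p x u where eq: "z = (p, x, u)"
    by (metis prod.collapse)
  have "x t \<in> {0, 1}" if "t \<in> {1..T}" for t
    using z that unfolding eq feasible_schedules_def by blast
  then have "(\<Sum>t = 1..T. x t * piecewise_affine K I a b (p t / x t) + c * x t + h * u t)
      = schedule_cost T K I a b c h z"
    unfolding eq schedule_cost_def prod.case by (intro sum.cong) fastforce+
  then show ?thesis
    using envelope_cost_on_hull [OF L part hull_inc [OF z [unfolded eq]]]
    by (simp add: eq)
qed

section \<open>Maximality of the envelope\<close>

definition set_output :: "(nat \<Rightarrow> real) \<Rightarrow> schedule \<Rightarrow> schedule"
  where "set_output r = (\<lambda>(p, x, u). (\<lambda>t. r t * x t, x, u))"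

lemma linear_set_output: "linear (set_output r)"
  by (rule linearI) (auto simp: set_output_def scaleR_fun_def fun_eq_iff algebra_simps)

text \<open>The output enters only the capacity bounds, and these hold for \<open>r t * x t\<close>
  because \<open>x t\<close> is 0 or 1.\<close>

lemma set_output_feasible:
  assumes "z \<in> feasible_schedules T L l pmin pmax"
    and "\<And>t. pmin \<le> r t" "\<And>t. r t \<le> pmax"
  shows "set_output r z \<in> feasible_schedules T L l pmin pmax"
  using assms by (auto simp: set_output_def feasible_schedules_def)

lemma convex_on_compose_linear:
  assumes f: "convex_on (convex hull S) f" and A: "linear A" and AS: "A ` S \<subseteq> S"
  shows "convex_on (convex hull S) (\<lambda>z. f (A z))"
proof -
  have "A ` (convex hull S) \<subseteq> convex hull S"
    using hull_mono [OF AS] convex_hull_linear_image [OF A] by metis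
  then have "A z \<in> convex hull S" if "z \<in> convex hull S" for z
    using that by blast
  then show ?thesis
    using f unfolding convex_on_def
    by (simp add: linear_add [OF A] linear_scale [OF A])
qed

lemma convex_underestimator_le_envelope_cost:
  assumes L: "1 \<le> L" "L + 1 \<le> T" and p: "pmin \<le> pmax"
    and part: "interval_partition K I {pmin..pmax}" "pieces_agree K I a b"
    and g: "convex_on (convex hull (feasible_schedules T L l pmin pmax)) g"
    and le: "\<And>z. z \<in> feasible_schedules T L l pmin pmax \<Longrightarrow> g z \<le> schedule_cost T K I a b c h z"
    and z: "z \<in> convex hull (feasible_schedules T L l pmin pmax)"
  shows "g z \<le> envelope_cost T K I a b c h z"
proof -
  let ?X = "feasible_schedules T L l pmin pmax"
  let ?\<phi> = "piecewise_affine K I a b"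
  obtain p x u where eq: "z = (p, x, u)"
    by (metis prod.collapse)
  note B = hull_feasible_schedules_bounds [OF L z [unfolded eq]]
  \<comment> \<open>Where the unit is off on average, any value in the output range would do;
    \<open>pmin\<close> is one.\<close>
  define r where "r t = (if x t = 0 then pmin else p t / x t)" for t
  \<comment> \<open>The cost of schedules with output \<open>r t * y t\<close>, extended linearly
    from binary \<open>y\<close>.\<close>
  define linear_cost :: "schedule \<Rightarrow> real" where
    "linear_cost = (\<lambda>(q, y, v). \<Sum>t = 1..T. y t * ?\<phi> (r t) + c * y t + h * v t)"
  have r: "pmin \<le> r t" "r t \<le> pmax" for t
    using B(1-3) [of t] p by (auto simp: r_def field_simps)
  \<comment> \<open>If \<open>x t = 0\<close>, the output bounds give
    \<open>p t = 0\<close>.\<close>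
  have "p t = r t * x t" for t
    using B(2,3) [of t] by (auto simp: r_def)
  then have fixed: "set_output r z = z"
    by (simp add: eq set_output_def fun_eq_iff)
  have "g (set_output r z) \<le> linear_cost z"
  proof (rule convex_on_le_affine_on_hull [where f = "\<lambda>z. g (set_output r z)", OF _ _ _ z])
    show "convex_on (convex hull ?X) (\<lambda>z. g (set_output r z))"
      using g linear_set_output
      by (rule convex_on_compose_linear) (blast intro: set_output_feasible r)
    show "linear_cost (s *\<^sub>R z + t *\<^sub>R w) = s * linear_cost z + t * linear_cost w" for z w s t
      by (simp add: linear_cost_def case_prod_beta scaleR_fun_def sum_distrib_left
          sum.distrib algebra_simps)
    show "g (set_output r w) \<le> linear_cost w" if w: "w \<in> ?X" for w
    proof -
      obtain q y v where w_eq: "w = (q, y, v)"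
        by (metis prod.collapse)
      have "y t \<in> {0, 1}" if "t \<in> {1..T}" for t
        using w that unfolding w_eq feasible_schedules_def by blast
      then have "schedule_cost T K I a b c h (set_output r w) = linear_cost w"
        unfolding w_eq schedule_cost_def set_output_def linear_cost_def prod.case
        by (intro sum.cong) fastforce+
      with le [OF set_output_feasible [OF w, of r]] r show ?thesis
        by simp
    qed
  qed
  \<comment> \<open>The two definitions of \<open>r t\<close> do not conflict: at
    \<open>x t = 0\<close> the value of \<open>\<phi>\<close> is multiplied by 0.\<close>
  also have "linear_cost z = envelope_cost T K I a b c h z"
    unfolding eq envelope_cost_on_hull [OF L part z [unfolded eq]] linear_cost_def prod.case
    by (rule sum.cong [OF refl]) (simp add: r_def)
  finally show ?thesis
    by (simp add: fixed)
qed

theorem theorem4: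
  fixes T L l :: nat
    and pmin pmax c h :: real
    and K :: "'k set"
    and I :: "'k \<Rightarrow> real set"
    and a b :: "'k \<Rightarrow> real"
  assumes "T \<ge> 2"
    and "1 \<le> L" and "L \<le> T - 1"
    and "1 \<le> l" and "l \<le> T - 1"
    and "0 \<le> pmin" and "pmin \<le> pmax"
    and "interval_partition K I {pmin..pmax}"
    and "pieces_agree K I a b"
    and "convex_on {pmin..pmax} (piecewise_affine K I a b)"
  shows "is_convex_envelope (feasible_schedules T L l pmin pmax)
    (schedule_cost T K I a b c h) (envelope_cost T K I a b c h)"
proof -
  have L: "1 \<le> L" "L + 1 \<le> T"
    using assms(1-3) by auto
  show ?thesis
    unfolding is_convex_envelope_def
  proof (intro conjI allI impI ballI)
    show "convex_on (convex hull (feasible_schedules T L l pmin pmax))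
        (envelope_cost T K I a b c h)"
      using L assms(8-10) by (rule envelope_cost_convex_on_hull)
    show "envelope_cost T K I a b c h z \<le> schedule_cost T K I a b c h z"
      if "z \<in> feasible_schedules T L l pmin pmax" for z
      using envelope_cost_eq_schedule_cost [OF L assms(8,9) that] by simp
    show "g z \<le> envelope_cost T K I a b c h z"
      if "convex_on (convex hull (feasible_schedules T L l pmin pmax)) g \<and>
          (\<forall>z\<in>feasible_schedules T L l pmin pmax. g z \<le> schedule_cost T K I a b c h z)"
        and "z \<in> convex hull (feasible_schedules T L l pmin pmax)" for g z
      using that convex_underestimator_le_envelope_cost [OF L assms(7-9)] by blast
  qed
qed

end
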